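(* Let $(S,\lhd)$ be a shelf and $\Bbbk$ a field. (1) A bicomplex structure on $T(\Bbbk S)$ is defined by the linear extensions of $${}^{\varepsilon}d(a_1,\ldots,a_n)=\sum_{i=1}^n(-1)^{i-1}(a_1\lhd a_i,\ldots,a_{i-1}\lhd a_i,a_{i+1},\ldots,a_n),$$ $$d^{\varepsilon}(a_1,\ldots,a_n)=\sum_{i=1}^n(-1)^{i-1}(a_1,\ldots,\widehat{a_i},\ldots,a_n).$$ (2) This bidifferential comes from the pre-bisimplicial structure given by $$d_{n;i}(a_1,\ldots,a_n)=(a_1\lhd a_i,\ldots,a_{i-1}\lhd a_i,a_{i+1},\ldots,a_n),\qquad d'_{n;i}(a_1,\ldots,a_n)=(a_1,\ldots,\widehat{a_i},\ldots,a_n).$$ (3) If $S$ is moreover a spindle, then, with $s_{n;i}(a_1,\ldots,a_n)=(a_1,\ldots,a_{i-1},a_i,a_i,a_{i+1},\ldots,a_n)$, the data $(T(\Bbbk S),d_{n;i},d'_{n;i},s_{n;i})$ form a weakly bisimplicial vector space. Consequently, the linear span $C^D_*(S)$ of the elements $(a_1,\ldots,a_n)\in S^{\times n}$ with $a_i=a_{i+1}$ for some $i$ is a sub-bicomplex of $(T(\Bbbk S),{}^{\varepsilon}d,d^{\varepsilon})$.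
   Context: A shelf is a set $S$ with a binary operation $\lhd$ such that $(a\lhd b)\lhd c=(a\lhd c)\lhd(b\lhd c)$ for all $a,b,c$; a spindle is a shelf with $a\lhd a=a$ for all $a$. $\Bbbk S$ is the vector space with basis $S$; $T(\Bbbk S)=\bigoplus_{n\ge0}(\Bbbk S)^{\otimes n}$, and $(\Bbbk S)^{\otimes n}$ has basis $S^{\times n}$, its elements written $(a_1,\ldots,a_n)$. Differentials vanish on degree $0$. A bicomplex is a graded space with two anticommuting square-zero maps of degree $-1$. Simplicial vocabulary, for vector spaces $V_n$ ($n\ge0$) with linear maps $d_{n;i},d'_{n;i}:V_n\to V_{n-1}$, $s_{n;i}:V_n\to V_{n+1}$, $1\le i\le n$ (first subscripts omitted, composites having source $V_n$): pre-bisimplicial: for $1\le i<j\le n$, $d_id_j=d_{j-1}d_i$, $d'_id'_j=d'_{j-1}d'_i$, $d_id'_j=d'_{j-1}d_i$, $d'_id_j=d_{j-1}d'_i$; the associated bidifferential is $\partial_n=\sum_i(-1)^{i-1}d_{n;i}$, $\partial'_n=\sum_i(-1)^{i-1}d'_{n;i}$; weakly bisimplicial: pre-bisimplicial, and moreover $s_is_j=s_{j+1}s_i$ for $1\le i\le j\le n$, and for both $\delta=d$ and $\delta=d'$: $\delta_is_j=s_{j-1}\delta_i$ for $1\le i<j\le n$, $\delta_is_j=s_j\delta_{i-1}$ for $1\le j$, $j+1<i\le n+1$, $\delta_is_i=\delta_{i+1}s_i$ for $1\le i\le n$. *)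

theory Defs
  imports Complex_Main "HOL-Library.Poly_Mapping"
begin

locale shelf =
  fixes S :: "'a set" and tri :: "'a \<Rightarrow> 'a \<Rightarrow> 'a" (infixl \<open>\<lhd>\<close> 70)
  assumes closed: "a \<in> S \<Longrightarrow> b \<in> S \<Longrightarrow> a \<lhd> b \<in> S"
    and self_distrib:
      "a \<in> S \<Longrightarrow> b \<in> S \<Longrightarrow> c \<in> S \<Longrightarrow> (a \<lhd> b) \<lhd> c = (a \<lhd> c) \<lhd> (b \<lhd> c)"

locale spindle = shelf +
  assumes idem: "a \<in> S \<Longrightarrow> a \<lhd> a = a"

text \<open>
  Vector spaces are subspaces of an ambient vector space given by its scalar multiplication;
  maps between them are functions on the ambient type, constrained only on the subspaces.
\<close>

definition linear_between ::
    "('k::field \<Rightarrow> 'v::ab_group_add \<Rightarrow> 'v) \<Rightarrow> 'v set \<Rightarrow> 'v set \<Rightarrow> ('v \<Rightarrow> 'v) \<Rightarrow> bool" where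
  "linear_between scale V W f \<longleftrightarrow>
     f ` V \<subseteq> W \<and>
     (\<forall>x\<in>V. \<forall>y\<in>V. f (x + y) = f x + f y) \<and>
     (\<forall>c. \<forall>x\<in>V. f (scale c x) = scale c (f x))"

text \<open>\<open>T\<close> is the internal direct sum of the \<open>V n\<close>.\<close>

locale graded_space = vector_space scale
  for scale :: "'k::field \<Rightarrow> 'v::ab_group_add \<Rightarrow> 'v" (infixr \<open>*s\<close> 75) +
  fixes T :: "'v set" and V :: "nat \<Rightarrow> 'v set"
  assumes subspace_total: "subspace T"
    and subspace_component: "\<And>n. subspace (V n)"
    and component_subset: "\<And>n. V n \<subseteq> T"
    and decomposition:
      "\<And>v. v \<in> T \<Longrightarrow>
         \<exists>!c :: nat \<Rightarrow> 'v. (\<forall>n. c n \<in> V n) \<and> finite {n. c n \<noteq> 0} \<and> v = (\<Sum>n | c n \<noteq> 0. c n)"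

text \<open>
  The grading starts at \<open>0\<close>, so degree \<open>-1\<close> means that the maps vanish on \<open>V 0\<close>.
\<close>

locale bicomplex = graded_space +
  fixes D D' :: "'b \<Rightarrow> 'b"
  assumes linear: "linear_between scale T T D" "linear_between scale T T D'"
    and degree_Suc: "D ` V (Suc n) \<subseteq> V n" "D' ` V (Suc n) \<subseteq> V n"
    and degree_0: "v \<in> V 0 \<Longrightarrow> D v = 0" "v \<in> V 0 \<Longrightarrow> D' v = 0"
    and square_zero: "v \<in> T \<Longrightarrow> D (D v) = 0" "v \<in> T \<Longrightarrow> D' (D' v) = 0"
    and anticommute: "v \<in> T \<Longrightarrow> D (D' v) + D' (D v) = 0"

definition sub_bicomplex ::
    "('k::field \<Rightarrow> 'v::ab_group_add \<Rightarrow> 'v) \<Rightarrow> 'v set \<Rightarrow> (nat \<Rightarrow> 'v set) \<Rightarrow> 'v set \<Rightarrow> (nat \<Rightarrow> 'v set)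
      \<Rightarrow> ('v \<Rightarrow> 'v) \<Rightarrow> ('v \<Rightarrow> 'v) \<Rightarrow> bool" where
  "sub_bicomplex scale C W T V D D' \<longleftrightarrow>
     bicomplex scale T V D D' \<and> C \<subseteq> T \<and> (\<forall>n. W n \<subseteq> V n) \<and> bicomplex scale C W D D'"

locale pre_bisimplicial = vector_space scale
  for scale :: "'k::field \<Rightarrow> 'v::ab_group_add \<Rightarrow> 'v" (infixr \<open>*s\<close> 75) +
  fixes V :: "nat \<Rightarrow> 'v set"
    and d d' :: "nat \<Rightarrow> nat \<Rightarrow> 'v \<Rightarrow> 'v"
  assumes subspace_component: "\<And>n. subspace (V n)"
    and linear_d:
      "\<And>n i. 1 \<le> i \<Longrightarrow> i \<le> n \<Longrightarrow> linear_between scale (V n) (V (n - 1)) (d n i)"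
    and linear_d':
      "\<And>n i. 1 \<le> i \<Longrightarrow> i \<le> n \<Longrightarrow> linear_between scale (V n) (V (n - 1)) (d' n i)"
    and d_d: "\<And>n i j v. 1 \<le> i \<Longrightarrow> i < j \<Longrightarrow> j \<le> n \<Longrightarrow> v \<in> V n \<Longrightarrow>
      d (n - 1) i (d n j v) = d (n - 1) (j - 1) (d n i v)"
    and d'_d': "\<And>n i j v. 1 \<le> i \<Longrightarrow> i < j \<Longrightarrow> j \<le> n \<Longrightarrow> v \<in> V n \<Longrightarrow>
      d' (n - 1) i (d' n j v) = d' (n - 1) (j - 1) (d' n i v)"
    and d_d': "\<And>n i j v. 1 \<le> i \<Longrightarrow> i < j \<Longrightarrow> j \<le> n \<Longrightarrow> v \<in> V n \<Longrightarrow>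
      d (n - 1) i (d' n j v) = d' (n - 1) (j - 1) (d n i v)"
    and d'_d: "\<And>n i j v. 1 \<le> i \<Longrightarrow> i < j \<Longrightarrow> j \<le> n \<Longrightarrow> v \<in> V n \<Longrightarrow>
      d' (n - 1) i (d n j v) = d (n - 1) (j - 1) (d' n i v)"

definition associated_differential ::
    "('k::field \<Rightarrow> 'v::ab_group_add \<Rightarrow> 'v) \<Rightarrow> (nat \<Rightarrow> nat \<Rightarrow> 'v \<Rightarrow> 'v) \<Rightarrow> nat \<Rightarrow> 'v \<Rightarrow> 'v" where
  "associated_differential scale d n v = (\<Sum>i=1..n. scale ((- 1) ^ (i - 1)) (d n i v))"

locale weakly_bisimplicial = pre_bisimplicial +
  fixes s :: "nat \<Rightarrow> nat \<Rightarrow> 'b \<Rightarrow> 'b"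
  assumes linear_s:
      "\<And>n i. 1 \<le> i \<Longrightarrow> i \<le> n \<Longrightarrow> linear_between scale (V n) (V (n + 1)) (s n i)"
    and s_s: "\<And>n i j v. 1 \<le> i \<Longrightarrow> i \<le> j \<Longrightarrow> j \<le> n \<Longrightarrow> v \<in> V n \<Longrightarrow>
      s (n + 1) i (s n j v) = s (n + 1) (j + 1) (s n i v)"
    and face_s_less: "\<And>\<delta> n i j v. \<delta> \<in> {d, d'} \<Longrightarrow> 1 \<le> i \<Longrightarrow> i < j \<Longrightarrow> j \<le> n \<Longrightarrow> v \<in> V n \<Longrightarrow>
      \<delta> (n + 1) i (s n j v) = s (n - 1) (j - 1) (\<delta> n i v)"
    and face_s_greater:
      "\<And>\<delta> n i j v. \<delta> \<in> {d, d'} \<Longrightarrow> 1 \<le> j \<Longrightarrow> j + 1 < i \<Longrightarrow> i \<le> n + 1 \<Longrightarrow> v \<in> V n \<Longrightarrow>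
      \<delta> (n + 1) i (s n j v) = s (n - 1) j (\<delta> n (i - 1) v)"
    and face_s_same: "\<And>\<delta> n i v. \<delta> \<in> {d, d'} \<Longrightarrow> 1 \<le> i \<Longrightarrow> i \<le> n \<Longrightarrow> v \<in> V n \<Longrightarrow>
      \<delta> (n + 1) i (s n i v) = \<delta> (n + 1) (i + 1) (s n i v)"

definition fscale :: "'k::field \<Rightarrow> ('b \<Rightarrow>\<^sub>0 'k) \<Rightarrow> ('b \<Rightarrow>\<^sub>0 'k)" where
  "fscale c p = Poly_Mapping.map ((*) c) p"

lemma lookup_fscale: "Poly_Mapping.lookup (fscale c p) x = c * Poly_Mapping.lookup p x"
  by (simp add: fscale_def Poly_Mapping.map.rep_eq Poly_Mapping.when_def)

interpretation free: vector_space "fscale :: 'k::field \<Rightarrow> ('b \<Rightarrow>\<^sub>0 'k) \<Rightarrow> _"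
  by unfold_locales
    (auto intro!: poly_mapping_eqI simp: lookup_fscale Poly_Mapping.lookup_add algebra_simps)

abbreviation basis_vec :: "'b \<Rightarrow> ('b \<Rightarrow>\<^sub>0 'k::field)" where
  "basis_vec x \<equiv> Poly_Mapping.single x 1"

definition linear_extension :: "('b \<Rightarrow> ('c \<Rightarrow>\<^sub>0 'k::field)) \<Rightarrow> ('b \<Rightarrow>\<^sub>0 'k) \<Rightarrow> ('c \<Rightarrow>\<^sub>0 'k)" where
  "linear_extension f p = (\<Sum>x\<in>Poly_Mapping.keys p. fscale (Poly_Mapping.lookup p x) (f x))"

text \<open>
  The tensor power \<open>(kS)\<^sup>\<otimes>\<^sup>n\<close> is taken with its basis \<open>S\<^sup>n\<close>: a tuple is a list of length
  \<open>n\<close> over \<open>S\<close> (the empty list spans degree \<open>0\<close>), and the tensor space is the space with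
  basis all lists over \<open>S\<close>.
\<close>

definition tuples :: "'a set \<Rightarrow> nat \<Rightarrow> 'a list set" where
  "tuples S n = {xs \<in> lists S. length xs = n}"

definition tensor_power :: "'a set \<Rightarrow> nat \<Rightarrow> ('a list \<Rightarrow>\<^sub>0 'k::field) set" where
  "tensor_power S n = {p. Poly_Mapping.keys p \<subseteq> tuples S n}"

definition tensor_space :: "'a set \<Rightarrow> ('a list \<Rightarrow>\<^sub>0 'k::field) set" where
  "tensor_space S = {p. Poly_Mapping.keys p \<subseteq> lists S}"

text \<open>
  Positions are counted from \<open>1\<close>, so \<open>a\<^sub>i\<close> is \<open>xs ! (i - 1)\<close>, and the functions are only meant for
  \<open>1 \<le> i \<le> length xs\<close>.
\<close>

definition act_face :: "('a \<Rightarrow> 'a \<Rightarrow> 'a) \<Rightarrow> nat \<Rightarrow> 'a list \<Rightarrow> 'a list" where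
  "act_face tri i xs = map (\<lambda>a. tri a (xs ! (i - 1))) (take (i - 1) xs) @ drop i xs"

definition omit_face :: "nat \<Rightarrow> 'a list \<Rightarrow> 'a list" where
  "omit_face i xs = take (i - 1) xs @ drop i xs"

definition duplicate :: "nat \<Rightarrow> 'a list \<Rightarrow> 'a list" where
  "duplicate i xs = take i xs @ drop (i - 1) xs"

text \<open>
  The maps below are given by the same formula in every degree, so the degree argument \<open>n\<close> of
  the bisimplicial structure is ignored.
\<close>

definition d_act :: "('a \<Rightarrow> 'a \<Rightarrow> 'a) \<Rightarrow> nat \<Rightarrow> nat \<Rightarrow> ('a list \<Rightarrow>\<^sub>0 'k::field) \<Rightarrow> ('a list \<Rightarrow>\<^sub>0 'k)" where
  "d_act tri n i = linear_extension (\<lambda>xs. basis_vec (act_face tri i xs))"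

definition d_omit :: "nat \<Rightarrow> nat \<Rightarrow> ('a list \<Rightarrow>\<^sub>0 'k::field) \<Rightarrow> ('a list \<Rightarrow>\<^sub>0 'k)" where
  "d_omit n i = linear_extension (\<lambda>xs. basis_vec (omit_face i xs))"

definition s_dup :: "nat \<Rightarrow> nat \<Rightarrow> ('a list \<Rightarrow>\<^sub>0 'k::field) \<Rightarrow> ('a list \<Rightarrow>\<^sub>0 'k)" where
  "s_dup n i = linear_extension (\<lambda>xs. basis_vec (duplicate i xs))"

text \<open>\<open>eps_d\<close> and \<open>d_eps\<close> carry the symbol \<open>\<epsilon>\<close> as left, respectively right, superscript.\<close>

definition eps_d :: "('a \<Rightarrow> 'a \<Rightarrow> 'a) \<Rightarrow> ('a list \<Rightarrow>\<^sub>0 'k::field) \<Rightarrow> ('a list \<Rightarrow>\<^sub>0 'k)" where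
  "eps_d tri = linear_extension
     (\<lambda>xs. \<Sum>i=1..length xs. fscale ((- 1) ^ (i - 1)) (basis_vec (act_face tri i xs)))"

definition d_eps :: "('a list \<Rightarrow>\<^sub>0 'k::field) \<Rightarrow> ('a list \<Rightarrow>\<^sub>0 'k)" where
  "d_eps = linear_extension
     (\<lambda>xs. \<Sum>i=1..length xs. fscale ((- 1) ^ (i - 1)) (basis_vec (omit_face i xs)))"

definition degenerate_tuples :: "'a set \<Rightarrow> nat \<Rightarrow> 'a list set" where
  "degenerate_tuples S n =
     {xs \<in> tuples S n. \<exists>i. 1 \<le> i \<and> i < n \<and> xs ! (i - 1) = xs ! i}"

definition CD_component :: "'a set \<Rightarrow> nat \<Rightarrow> ('a list \<Rightarrow>\<^sub>0 'k::field) set" where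
  "CD_component S n = free.span (basis_vec ` degenerate_tuples S n)"

definition CD :: "'a set \<Rightarrow> ('a list \<Rightarrow>\<^sub>0 'k::field) set" where
  "CD S = free.span (basis_vec ` (\<Union>n. degenerate_tuples S n))"

end

theory Submission
  imports Defs
begin

text \<open>
  Deleting an entry is the face map \<^term>\<open>act_face\<close> for the trivial operation
  \<open>a \<lhd>\<^sub>0 b = a\<close>, so both families of faces are instances of one construction, and both
  differentials are the map \<^term>\<open>eps_d\<close> for an operation. For two operations \<open>t\<close>, \<open>u\<close> and
  \<open>i < j\<close>, the faces satisfy \<open>d\<^sub>i d'\<^sub>j = d'\<^bsub>j-1\<^esub> d\<^sub>i\<close> as soon as \<open>u\<close> distributes over \<open>t\<close>:
  the two sides can differ only in front of position \<open>i\<close>, where they have the entries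
  \<open>t (u a y) (u x y)\<close> and \<open>u (t a x) y\<close> (\<open>act_face_act_face\<close>). Self-distributivity is the case
  \<open>t = u = (\<lhd>)\<close>; in the other three cases, where \<open>t\<close> or \<open>u\<close> is trivial, distributivity is automatic.

  From these four relations the bicomplex identities follow by cancelling half of a double sum. In
  \<open>\<partial> \<partial>' = \<Sum> (-1)\<^sup>i\<^sup>+\<^sup>j d\<^sub>i d'\<^sub>j\<close>, the relation turns the part \<open>i < j\<close> into minus the part
  \<open>i \<ge> j\<close> of \<open>\<partial>' \<partial>\<close>. Hence, writing \<open>U(d, d')\<close> for the part \<open>i \<ge> j\<close> of \<open>\<partial> \<partial>'\<close>,
  \<open>\<partial> \<partial>' = U(d, d') - U(d', d)\<close> (\<open>associated_differential_compose\<close>). This expression is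
  antisymmetric in \<open>d\<close> and \<open>d'\<close>, which gives anticommutation, and it vanishes for \<open>d = d'\<close>, which
  gives square zero, in characteristic two as well.

  In a spindle, the degeneracies satisfy the weakly bisimplicial relations; idempotence enters only
  in \<open>\<delta>\<^sub>i s\<^sub>i = \<delta>\<^bsub>i+1\<^esub> s\<^sub>i\<close>. A tuple with two equal neighbours is \<open>s\<^sub>j\<close> of a shorter
  tuple, and in \<open>\<partial> s\<^sub>j v\<close> the faces \<open>j\<close> and \<open>j + 1\<close> cancel while each other face moves past
  the degeneracy. So \<open>\<partial>\<close> preserves the span of the images of the degeneracies
  (\<open>associated_differential_degenerate\<close>), and this span is \<open>C\<^sup>D\<close>.
\<close>

section \<open>Alternating sums of face maps\<close>

lemma linear_betweenD: "linear_between scale V W f \<Longrightarrow> v \<in> V \<Longrightarrow> f v \<in> W"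
  unfolding linear_between_def by blast

lemma linear_between_add:
  "linear_between scale V W f \<Longrightarrow> u \<in> V \<Longrightarrow> v \<in> V \<Longrightarrow> f (u + v) = f u + f v"
  unfolding linear_between_def by blast

lemma linear_between_restrict:
  "linear_between scale V V f \<Longrightarrow> W \<subseteq> V \<Longrightarrow> f ` W \<subseteq> W \<Longrightarrow> linear_between scale W W f"
  unfolding linear_between_def by (simp add: subset_iff)

context vector_space
begin

lemma linear_between_sum_scale:
  assumes f: "linear_between scale V W f" and V: "subspace V"
    and "finite I" and "\<And>i. i \<in> I \<Longrightarrow> x i \<in> V"
  shows "f (\<Sum>i\<in>I. scale (c i) (x i)) = (\<Sum>i\<in>I. scale (c i) (f (x i)))"
proof -
  have f0: "f 0 = 0"
  proof -
    have "f (scale 0 0) = scale 0 (f 0)"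
      using f subspace_0[OF V] unfolding linear_between_def by blast
    then show ?thesis by simp
  qed
  show ?thesis using assms(3,4)
  proof (induction I rule: finite_induct)
    case empty
    then show ?case by (simp add: f0)
  next
    case (insert i I)
    have "scale (c i) (x i) \<in> V" "(\<Sum>i\<in>I. scale (c i) (x i)) \<in> V"
      using insert.prems by (auto intro!: subspace_sum subspace_scale V)
    moreover have "f (scale (c i) (x i)) = scale (c i) (f (x i))"
      using f insert.prems unfolding linear_between_def by blast
    ultimately show ?case
      using f insert unfolding linear_between_def by (simp del: scale_eq_0_iff)
  qed
qed

lemma associated_differential_mem:
  assumes "subspace W" "\<And>i. 1 \<le> i \<Longrightarrow> i \<le> n \<Longrightarrow> d n i v \<in> W"
  shows "associated_differential scale d n v \<in> W"
  unfolding associated_differential_def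
  using assms by (intro subspace_sum subspace_scale) auto

text \<open>
  The substitution \<open>(p, q) = (j - 1, i)\<close> is a bijection from the pairs with \<open>i < j\<close> onto those with
  \<open>q \<le> p\<close>. It lowers the sum of the indices by one, whence the sign.
\<close>

lemma alternating_sum_shift:
  fixes x y :: "nat \<Rightarrow> nat \<Rightarrow> 'b"
  assumes xy: "\<And>i j. 1 \<le> i \<Longrightarrow> i < j \<Longrightarrow> j \<le> n \<Longrightarrow> x i j = y (j - 1) i"
  shows "(\<Sum>(i, j) \<in> {(i, j). 1 \<le> i \<and> i < j \<and> j \<le> n}. scale ((- 1) ^ (i + j)) (x i j))
    = - (\<Sum>(p, q) \<in> {(p, q). 1 \<le> q \<and> q \<le> p \<and> p \<le> n - 1}. scale ((- 1) ^ (p + q)) (y p q))"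
proof -
  have "(\<Sum>(i, j) \<in> {(i, j). 1 \<le> i \<and> i < j \<and> j \<le> n}. scale ((- 1) ^ (i + j)) (x i j))
    = (\<Sum>(p, q) \<in> {(p, q). 1 \<le> q \<and> q \<le> p \<and> p \<le> n - 1}. - scale ((- 1) ^ (p + q)) (y p q))"
  proof (rule sum.reindex_bij_witness[where i = "\<lambda>(p, q). (q, p + 1)" and j = "\<lambda>(i, j). (j - 1, i)"])
    fix a assume "a \<in> {(i, j). 1 \<le> i \<and> i < j \<and> j \<le> n}"
    then obtain i k where a: "a = (i, Suc k)" "1 \<le> i" "i \<le> k" "Suc k \<le> n"
      by (cases a; cases "snd a") auto
    then show "(case case a of (i, j) \<Rightarrow> (j - 1, i) of (p, q) \<Rightarrow> - scale ((- 1) ^ (p + q)) (y p q))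
      = (case a of (i, j) \<Rightarrow> scale ((- 1) ^ (i + j)) (x i j))"
      using xy[of i "Suc k"] by (simp add: add.commute)
  qed auto
  then show ?thesis by (simp add: sum_negf case_prod_beta)
qed

text \<open>
  Only the one mixed relation is assumed, so the lemma applies to two equal families as well as to two
  different ones in either order. It has the form of a difference, rather than of a vanishing
  symmetrised sum, because from \<open>2 \<partial>\<^sup>2 = 0\<close> one could not conclude in characteristic two.
\<close>

lemma associated_differential_compose:
  assumes W: "subspace W"
    and d: "\<And>i. 1 \<le> i \<Longrightarrow> i \<le> n - 1 \<Longrightarrow> linear_between scale W U (d (n - 1) i)"
    and e: "\<And>j. 1 \<le> j \<Longrightarrow> j \<le> n \<Longrightarrow> e n j v \<in> W"
    and rel: "\<And>i j. 1 \<le> i \<Longrightarrow> i < j \<Longrightarrow> j \<le> n \<Longrightarrow>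
      d (n - 1) i (e n j v) = e (n - 1) (j - 1) (d n i v)"
  defines "P \<equiv> {(p, q). 1 \<le> q \<and> q \<le> p \<and> p \<le> n - 1}"
  shows "associated_differential scale d (n - 1) (associated_differential scale e n v)
    = (\<Sum>(p, q) \<in> P. scale ((- 1) ^ (p + q)) (d (n - 1) p (e n q v)))
      - (\<Sum>(p, q) \<in> P. scale ((- 1) ^ (p + q)) (e (n - 1) p (d n q v)))"
proof -
  let ?Q = "{(i, j). 1 \<le> i \<and> i < j \<and> j \<le> n}"
  let ?g = "\<lambda>(i, j). scale ((- 1) ^ (i + j)) (d (n - 1) i (e n j v))"
  have sign: "(- 1 :: 'a) ^ (i - 1) * (- 1) ^ (j - 1) = (- 1) ^ (i + j)" if "1 \<le> i" "1 \<le> j" for i j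
    using that by (cases i; cases j) (auto simp: power_add)
  have split: "{1..n - 1} \<times> {1..n} = P \<union> ?Q" "P \<inter> ?Q = {}"
    unfolding P_def by auto
  have "finite (P \<union> ?Q)"
    unfolding split(1)[symmetric] by simp
  then have fin: "finite P" "finite ?Q" by simp_all
  have "associated_differential scale d (n - 1) (associated_differential scale e n v)
    = (\<Sum>i = 1..n - 1. scale ((- 1) ^ (i - 1))
        (\<Sum>j = 1..n. scale ((- 1) ^ (j - 1)) (d (n - 1) i (e n j v))))"
    unfolding associated_differential_def
  proof (rule sum.cong[OF refl])
    fix i assume "i \<in> {1..n - 1}"
    then have "linear_between scale W U (d (n - 1) i)" using d by simp
    from linear_between_sum_scale[OF this W, of "{1..n}" "\<lambda>j. e n j v"] e
    show "scale ((- 1) ^ (i - 1)) (d (n - 1) i (\<Sum>j = 1..n. scale ((- 1) ^ (j - 1)) (e n j v)))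
      = scale ((- 1) ^ (i - 1)) (\<Sum>j = 1..n. scale ((- 1) ^ (j - 1)) (d (n - 1) i (e n j v)))"
      by simp
  qed
  also have "\<dots> = (\<Sum>i = 1..n - 1. \<Sum>j = 1..n. ?g (i, j))"
    unfolding scale_sum_right scale_scale by (intro sum.cong refl) (simp add: sign del: One_nat_def)
  also have "\<dots> = sum ?g ({1..n - 1} \<times> {1..n})"
    by (simp add: sum.cartesian_product)
  also have "\<dots> = sum ?g P + sum ?g ?Q"
    unfolding split(1) by (rule sum.union_disjoint[OF fin split(2)])
  finally show ?thesis
    using alternating_sum_shift[of n "\<lambda>i j. d (n - 1) i (e n j v)" "\<lambda>p q. e (n - 1) p (d n q v)", OF rel]
    unfolding P_def by simp
qed

end

context pre_bisimplicial
begin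

lemma face_mem:
  assumes "\<delta> \<in> {d, d'}" "1 \<le> i" "i \<le> n" "v \<in> V n"
  shows "\<delta> n i v \<in> V (n - 1)"
  using assms(1) linear_betweenD[OF linear_d[OF assms(2,3)] assms(4)]
    linear_betweenD[OF linear_d'[OF assms(2,3)] assms(4)] by (elim insertE emptyE) simp_all

lemma associated_differential_compose_faces:
  assumes "\<delta> \<in> {d, d'}" "\<epsilon> \<in> {d, d'}" "v \<in> V n"
  defines "P \<equiv> {(p, q). 1 \<le> q \<and> q \<le> p \<and> p \<le> n - 1}"
  shows "associated_differential scale \<delta> (n - 1) (associated_differential scale \<epsilon> n v)
    = (\<Sum>(p, q) \<in> P. scale ((- 1) ^ (p + q)) (\<delta> (n - 1) p (\<epsilon> n q v)))
      - (\<Sum>(p, q) \<in> P. scale ((- 1) ^ (p + q)) (\<epsilon> (n - 1) p (\<delta> n q v)))"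
  unfolding P_def
proof (rule associated_differential_compose[of "V (n - 1)" n "V (n - 1 - 1)"])
  show "linear_between scale (V (n - 1)) (V (n - 1 - 1)) (\<delta> (n - 1) i)" if "1 \<le> i" "i \<le> n - 1" for i
    using assms(1) linear_d[OF that] linear_d'[OF that] by auto
  show "\<delta> (n - 1) i (\<epsilon> n j v) = \<epsilon> (n - 1) (j - 1) (\<delta> n i v)" if "1 \<le> i" "i < j" "j \<le> n" for i j
    using assms(1,2)
    by (elim insertE emptyE; hypsubst)
      (rule d_d[OF that assms(3)] d_d'[OF that assms(3)] d'_d[OF that assms(3)] d'_d'[OF that assms(3)])+
qed (rule subspace_component, rule face_mem[OF assms(2) _ _ assms(3)])

lemma associated_differential_square:
  assumes "\<delta> \<in> {d, d'}" "v \<in> V n"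
  shows "associated_differential scale \<delta> (n - 1) (associated_differential scale \<delta> n v) = 0"
  unfolding associated_differential_compose_faces[OF assms(1,1,2)] by (rule diff_self)

lemma associated_differential_anticommute:
  assumes "v \<in> V n"
  shows "associated_differential scale d (n - 1) (associated_differential scale d' n v)
    + associated_differential scale d' (n - 1) (associated_differential scale d n v) = 0"
  using associated_differential_compose_faces[of d d', OF _ _ assms]
    associated_differential_compose_faces[of d' d, OF _ _ assms] by simp

end

text \<open>
  The faces \<open>j\<close> and \<open>j + 1\<close> agree on \<open>s\<^sub>j v\<close> and come with opposite signs; every other face
  commutes with the degeneracy up to a shift of indices and therefore lands in the image of a
  degeneracy one degree lower.
\<close>

lemma (in weakly_bisimplicial) associated_differential_degenerate:
  assumes \<delta>: "\<delta> \<in> {d, d'}" and j: "1 \<le> j" "j \<le> n" and v: "v \<in> V n"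
  shows "associated_differential scale \<delta> (n + 1) (s n j v)
    \<in> span (\<Union>k\<in>{1..n - 1}. s (n - 1) k ` V (n - 1))" (is "_ \<in> ?Z")
proof -
  let ?f = "\<lambda>i. scale ((- 1) ^ (i - 1)) (\<delta> (n + 1) i (s n j v))"
  have "?f i \<in> ?Z" if i: "i \<in> {1..n + 1} - {j, j + 1}" for i
  proof (cases "i < j")
    case True
    have "\<delta> n i v \<in> V (n - 1)" using i True j by (intro face_mem[OF \<delta> _ _ v]) auto
    moreover have "\<delta> (n + 1) i (s n j v) = s (n - 1) (j - 1) (\<delta> n i v)"
      using i True j by (intro face_s_less[OF \<delta> _ _ _ v]) auto
    moreover have "j - 1 \<in> {1..n - 1}" using i True j by auto
    ultimately show ?thesis by (intro span_scale span_base) auto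
  next
    case False
    have "\<delta> n (i - 1) v \<in> V (n - 1)" using i False j by (intro face_mem[OF \<delta> _ _ v]) auto
    moreover have "\<delta> (n + 1) i (s n j v) = s (n - 1) j (\<delta> n (i - 1) v)"
      using i False j by (intro face_s_greater[OF \<delta> _ _ _ v]) auto
    moreover have "j \<in> {1..n - 1}" using i False j by auto
    ultimately show ?thesis by (intro span_scale span_base) auto
  qed
  then have "sum ?f ({1..n + 1} - {j, j + 1}) \<in> ?Z"
    by (intro span_sum)
  moreover have "sum ?f {j, j + 1} = 0"
  proof -
    have "(- 1 :: 'a) ^ j = - ((- 1) ^ (j - 1))" using j by (cases j) auto
    then show ?thesis using face_s_same[OF \<delta> j v] by simp
  qed
  moreover have "sum ?f {1..n + 1} = sum ?f ({1..n + 1} - {j, j + 1}) + sum ?f {j, j + 1}"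
    using j by (intro sum.subset_diff) auto
  ultimately show ?thesis
    unfolding associated_differential_def by simp
qed

section \<open>Bicomplexes on graded spaces\<close>

context graded_space
begin

text \<open>
  Reduces additive statements about the total space to homogeneous elements.
\<close>

lemma decomposed_induct [consumes 1, case_names zero add component]:
  assumes "v \<in> T"
    and "P 0"
    and "\<And>u w. u \<in> T \<Longrightarrow> w \<in> T \<Longrightarrow> P u \<Longrightarrow> P w \<Longrightarrow> P (u + w)"
    and "\<And>n u. u \<in> V n \<Longrightarrow> P u"
  shows "P v"
proof -
  obtain c where c: "\<And>n. c n \<in> V n" "finite {n. c n \<noteq> 0}" "v = (\<Sum>n | c n \<noteq> 0. c n)"
    using decomposition[OF assms(1)] by blast
  have "(\<Sum>n\<in>N. c n) \<in> T \<and> P (\<Sum>n\<in>N. c n)" if "finite N" for N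
    using that
  proof (induction N rule: finite_induct)
    case empty
    then show ?case using assms(2) subspace_0[OF subspace_total] by simp
  next
    case (insert n N)
    then show ?case
      using assms(3)[of "c n"] assms(4)[OF c(1)] c(1)[of n] component_subset[of n]
        subspace_add[OF subspace_total, of "c n"] by auto
  qed
  then show ?thesis using c by blast
qed

end

text \<open>
  The identities hold in each degree by the computation with faces, and both sides are additive.
\<close>

lemma bicomplex_of_pre_bisimplicial:
  assumes "graded_space scale T V" "pre_bisimplicial scale V d d'"
    and D: "linear_between scale T T D" "\<And>n v. v \<in> V n \<Longrightarrow> D v = associated_differential scale d n v"
    and D': "linear_between scale T T D'" "\<And>n v. v \<in> V n \<Longrightarrow> D' v = associated_differential scale d' n v"
  shows "bicomplex scale T V D D'"
proof -
  interpret graded_space scale T V by fact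
  interpret pre_bisimplicial scale V d d' by fact
  have mem: "D v \<in> V (n - 1)" "D' v \<in> V (n - 1)" if "v \<in> V n" for n v
    using that face_mem
    by (auto simp: D D' intro!: associated_differential_mem subspace_component)
  have T: "D v \<in> T" "D' v \<in> T" if "v \<in> T" for v
    using that linear_betweenD[OF D(1)] linear_betweenD[OF D'(1)] by auto
  have D_add: "D (u + w) = D u + D w" "D' (u + w) = D' u + D' w" if "u \<in> T" "w \<in> T" for u w
    using that linear_between_add[OF D(1)] linear_between_add[OF D'(1)] by auto
  have zero: "D 0 = 0" "D' 0 = 0"
    using D(2) D'(2) subspace_0[OF subspace_component, of 0]
    by (auto simp: associated_differential_def)
  show ?thesis
  proof
    show "D ` V (Suc n) \<subseteq> V n" "D' ` V (Suc n) \<subseteq> V n" for n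
      using mem[of _ "Suc n"] by auto
    show "D v = 0" "D' v = 0" if "v \<in> V 0" for v
      using that by (auto simp: D D' associated_differential_def)
    show "D (D v) = 0" if "v \<in> T" for v using that
    proof (induction v rule: decomposed_induct)
      case (component n u)
      then show ?case
        using associated_differential_square[of d] D(2)[OF mem(1)] D(2) by simp
    qed (auto simp: zero D_add T)
    show "D' (D' v) = 0" if "v \<in> T" for v using that
    proof (induction v rule: decomposed_induct)
      case (component n u)
      then show ?case
        using associated_differential_square[of d'] D'(2)[OF mem(2)] D'(2) by simp
    qed (auto simp: zero D_add T)
    show "D (D' v) + D' (D v) = 0" if "v \<in> T" for v using that
    proof (induction v rule: decomposed_induct)
      case (add u w)
      have "D (D' (u + w)) + D' (D (u + w)) = (D (D' u) + D' (D u)) + (D (D' w) + D' (D w))"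
        using add.hyps by (simp add: D_add T algebra_simps)
      then show ?case using add.IH by simp
    next
      case (component n u)
      then show ?case
        using associated_differential_anticommute D(2)[OF mem(2)] D(2) D'(2)[OF mem(1)] D'(2) by simp
    qed (auto simp: zero)
  qed (use D(1) D'(1) in auto)
qed

text \<open>
  The identities are inherited from the ambient bicomplex. Since the maps vanish in degree zero, it
  suffices to check positive degrees to see that the subspace is preserved.
\<close>

lemma sub_bicomplexI:
  assumes "bicomplex scale T V D D'" "graded_space scale C W"
    and CT: "C \<subseteq> T" and WV: "\<And>n. W n \<subseteq> V n"
    and deg: "\<And>n. D ` W (Suc n) \<subseteq> W n" "\<And>n. D' ` W (Suc n) \<subseteq> W n"
  shows "sub_bicomplex scale C W T V D D'"
proof -
  interpret T: bicomplex scale T V D D' by fact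
  interpret C: graded_space scale C W by fact
  have add: "D (u + w) = D u + D w" "D' (u + w) = D' u + D' w" if "u \<in> C" "w \<in> C" for u w
    using linear_between_add[OF T.linear(1)] linear_between_add[OF T.linear(2)]
      subsetD[OF CT that(1)] subsetD[OF CT that(2)] by simp_all
  have W0: "D v = 0" "D' v = 0" if "v \<in> W 0" for v
    using T.degree_0 subsetD[OF WV that] by simp_all
  have W: "D v \<in> C \<and> D' v \<in> C" if "v \<in> W n" for n v
  proof (cases n)
    case 0
    then show ?thesis using that W0 T.subspace_0[OF C.subspace_total] by simp
  next
    case (Suc m)
    then have "D v \<in> W m" "D' v \<in> W m" using that deg[of m] by blast+
    then show ?thesis using C.component_subset[of m] by blast
  qed
  have C: "D v \<in> C \<and> D' v \<in> C" if "v \<in> C" for v using that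
  proof (induction v rule: C.decomposed_induct)
    case zero
    then show ?case using W[OF T.subspace_0[OF C.subspace_component]] by blast
  next
    case (component n u)
    then show ?case by (rule W)
  qed (simp add: add T.subspace_add[OF C.subspace_total])
  have "bicomplex scale C W D D'"
  proof
    show "linear_between scale C C D" "linear_between scale C C D'"
      by (rule linear_between_restrict[OF _ CT]; use T.linear C in blast)+
    show "D (D v) = 0" "D' (D' v) = 0" "D (D' v) + D' (D v) = 0" if "v \<in> C" for v
      using T.square_zero T.anticommute subsetD[OF CT that] by simp_all
  qed (rule deg W0; assumption?)+
  then show ?thesis
    unfolding sub_bicomplex_def by (simp add: assms(1) CT WV)
qed

section \<open>Linear extensions from a basis\<close>

text \<open>
  Summing over any finite set that contains the support allows linear extensions of different vectors to
  be compared term by term.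
\<close>

lemma linear_extension_superset:
  assumes "finite A" "Poly_Mapping.keys p \<subseteq> A"
  shows "linear_extension f p = (\<Sum>x\<in>A. fscale (Poly_Mapping.lookup p x) (f x))"
  unfolding linear_extension_def using assms
  by (intro sum.mono_neutral_left) (auto simp: in_keys_iff)

lemma linear_extension_module_hom:
  "module_hom fscale fscale (linear_extension f :: ('b \<Rightarrow>\<^sub>0 'k::field) \<Rightarrow> ('c \<Rightarrow>\<^sub>0 'k))"
proof -
  have "linear_extension f (p + q) = linear_extension f p + linear_extension f q" for p q
  proof -
    let ?A = "Poly_Mapping.keys p \<union> Poly_Mapping.keys q"
    show ?thesis
      using linear_extension_superset[of ?A p f] linear_extension_superset[of ?A q f]
        linear_extension_superset[of ?A "p + q" f] keys_add[of p q]
      by (simp add: lookup_add free.scale_left_distrib sum.distrib)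
  qed
  moreover have "linear_extension f (fscale c p) = fscale c (linear_extension f p)" for c p
  proof -
    have "Poly_Mapping.keys (fscale c p) \<subseteq> Poly_Mapping.keys p"
      by (auto simp: in_keys_iff lookup_fscale)
    then show ?thesis
      using linear_extension_superset[of "Poly_Mapping.keys p" "fscale c p" f]
      by (simp add: linear_extension_def[of f p] lookup_fscale free.scale_sum_right)
  qed
  ultimately show ?thesis
    by (intro module_hom.intro module_hom_axioms.intro free.module_axioms) auto
qed

lemma linear_extension_basis_vec [simp]: "linear_extension f (basis_vec x) = f x"
  by (simp add: linear_extension_def)

lemma expand_in_basis: "linear_extension basis_vec p = p"
proof (rule poly_mapping_eqI)
  fix x
  have "Poly_Mapping.lookup (linear_extension basis_vec p) x
    = (\<Sum>y\<in>Poly_Mapping.keys p. if y = x then Poly_Mapping.lookup p y else 0)"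
    unfolding linear_extension_def lookup_sum
    by (intro sum.cong) (auto simp: lookup_fscale lookup_single when_def)
  then show "Poly_Mapping.lookup (linear_extension basis_vec p) x = Poly_Mapping.lookup p x"
    by (auto simp: in_keys_iff)
qed

lemma linear_extension_cong:
  "(\<And>x. x \<in> Poly_Mapping.keys p \<Longrightarrow> f x = g x) \<Longrightarrow> linear_extension f p = linear_extension g p"
  unfolding linear_extension_def by (intro sum.cong) auto

lemma linear_extension_linear_extension:
  "linear_extension g (linear_extension f p) = linear_extension (\<lambda>x. linear_extension g (f x)) p"
proof -
  interpret g: module_hom fscale fscale "linear_extension g"
    by (rule linear_extension_module_hom)
  show ?thesis
    unfolding linear_extension_def[of f p] linear_extension_def[of "\<lambda>x. linear_extension g (f x)" p]
    by (simp add: g.sum g.scale)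
qed

lemma linear_extension_sum_scale:
  shows "linear_extension (\<lambda>x. \<Sum>i\<in>I. fscale (c i) (f i x)) p = (\<Sum>i\<in>I. fscale (c i) (linear_extension (f i) p))"
  unfolding linear_extension_def free.scale_sum_right
  by (subst sum.swap) (simp add: mult.commute)

definition supported_on :: "'b set \<Rightarrow> ('b \<Rightarrow>\<^sub>0 'k::field) set" where
  "supported_on A = {p. Poly_Mapping.keys p \<subseteq> A}"

lemma subspace_supported_on: "free.subspace (supported_on A)"
proof (rule free.subspaceI)
  show "p + q \<in> supported_on A" if "p \<in> supported_on A" "q \<in> supported_on A" for p q
    using that keys_add[of p q] unfolding supported_on_def by blast
  show "fscale c p \<in> supported_on A" if "p \<in> supported_on A" for c p
    using that by (auto simp: supported_on_def in_keys_iff lookup_fscale)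
qed (simp add: supported_on_def)

lemma basis_vec_supported_on [simp]: "basis_vec x \<in> supported_on A \<longleftrightarrow> x \<in> A"
  by (simp add: supported_on_def)

lemma linear_between_linear_extension:
  assumes "\<And>x. x \<in> A \<Longrightarrow> f x \<in> W" "free.subspace W"
  shows "linear_between fscale (supported_on A) W (linear_extension f)"
proof -
  interpret f: module_hom fscale fscale "linear_extension f"
    by (rule linear_extension_module_hom)
  have "linear_extension f p \<in> W" if "p \<in> supported_on A" for p
    unfolding linear_extension_def using assms that
    by (intro free.subspace_sum free.subspace_scale) (auto simp: supported_on_def)
  then show ?thesis
    unfolding linear_between_def by (auto simp: f.add f.scale)
qed

text \<open>
  Describing spans of basis vectors by supports makes the decomposition into degrees a matter of
  restricting coefficient functions.
\<close>

lemma span_basis_vec: "free.span (basis_vec ` A) = supported_on A"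
proof
  show "free.span (basis_vec ` A) \<subseteq> supported_on A"
    by (intro free.span_minimal subspace_supported_on) auto
  have "linear_between fscale (supported_on A) (free.span (basis_vec ` A)) (linear_extension basis_vec)"
    by (intro linear_between_linear_extension) (auto intro: free.span_base)
  then show "supported_on A \<subseteq> free.span (basis_vec ` A)"
    by (auto simp: linear_between_def expand_in_basis)
qed

lemma lookup_homogeneous_sum:
  assumes "finite {n. c n \<noteq> 0}" "\<And>n. c n \<in> supported_on {x \<in> A. deg x = n}"
  shows "Poly_Mapping.lookup (\<Sum>n | c n \<noteq> 0. c n) x = Poly_Mapping.lookup (c (deg x)) x"
proof -
  have "Poly_Mapping.lookup (c n) x = (if n = deg x then Poly_Mapping.lookup (c n) x else 0)" for n
    using assms(2)[of n] by (auto simp: supported_on_def in_keys_iff subset_iff)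
  then have "Poly_Mapping.lookup (\<Sum>n | c n \<noteq> 0. c n) x
    = (\<Sum>n | c n \<noteq> 0. if n = deg x then Poly_Mapping.lookup (c n) x else 0)"
    unfolding lookup_sum by (intro sum.cong) auto
  then show ?thesis using assms(1) by auto
qed

text \<open>
  Any degree function on a basis grades the space. The component of \<open>v\<close> in degree \<open>n\<close> is its
  restriction to the basis elements of degree \<open>n\<close>, and \<open>lookup_homogeneous_sum\<close> shows that there is
  no other choice.
\<close>

lemma graded_space_supported_on:
  "graded_space fscale (supported_on A :: ('b \<Rightarrow>\<^sub>0 'k::field) set) (\<lambda>n. supported_on {x \<in> A. deg x = n})"
proof
  fix v :: "'b \<Rightarrow>\<^sub>0 'k" assume v: "v \<in> supported_on A"
  define c where "c n = linear_extension (\<lambda>x. if deg x = n then basis_vec x else 0) v" for n :: nat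
  have look: "Poly_Mapping.lookup (c n) x = (if deg x = n then Poly_Mapping.lookup v x else 0)" for n x
  proof -
    have "Poly_Mapping.lookup (c n) x
      = (\<Sum>y\<in>Poly_Mapping.keys v. if y = x then if deg x = n then Poly_Mapping.lookup v x else 0 else 0)"
      unfolding c_def linear_extension_def lookup_sum
      by (intro sum.cong) (auto simp: lookup_fscale lookup_single when_def)
    then show ?thesis by (auto simp: in_keys_iff)
  qed
  have mem: "c n \<in> supported_on {x \<in> A. deg x = n}" for n
    using v by (auto simp: supported_on_def in_keys_iff look subset_iff)
  have "{n. c n \<noteq> 0} \<subseteq> deg ` Poly_Mapping.keys v"
  proof
    fix n assume "n \<in> {n. c n \<noteq> 0}"
    then obtain x where "Poly_Mapping.lookup (c n) x \<noteq> 0"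
      by (metis mem_Collect_eq lookup_zero poly_mapping_eqI)
    then show "n \<in> deg ` Poly_Mapping.keys v"
      by (auto simp: look in_keys_iff split: if_splits)
  qed
  then have fin: "finite {n. c n \<noteq> 0}"
    by (rule finite_subset) simp
  show "\<exists>!c. (\<forall>n. c n \<in> supported_on {x \<in> A. deg x = n}) \<and> finite {n. c n \<noteq> 0}
    \<and> v = (\<Sum>n | c n \<noteq> 0. c n)"
  proof (rule ex1I[of _ c])
    show "(\<forall>n. c n \<in> supported_on {x \<in> A. deg x = n}) \<and> finite {n. c n \<noteq> 0}
      \<and> v = (\<Sum>n | c n \<noteq> 0. c n)"
    proof (intro conjI allI mem fin poly_mapping_eqI)
      fix x
      show "Poly_Mapping.lookup v x = Poly_Mapping.lookup (\<Sum>n | c n \<noteq> 0. c n) x"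
        by (simp add: lookup_homogeneous_sum[of c A deg, OF fin mem] look)
    qed
  next
    fix b assume b: "(\<forall>n. b n \<in> supported_on {x \<in> A. deg x = n}) \<and> finite {n. b n \<noteq> 0}
      \<and> v = (\<Sum>n | b n \<noteq> 0. b n)"
    have "Poly_Mapping.lookup (b n) x = Poly_Mapping.lookup (c n) x" for n x
    proof (cases "deg x = n")
      case True
      then show ?thesis
        using b lookup_homogeneous_sum[of b A deg x] by (simp add: look)
    next
      case False
      then show ?thesis
        using b by (auto simp: look supported_on_def in_keys_iff subset_iff)
    qed
    then show "b = c" by (auto intro!: poly_mapping_eqI)
  qed
qed (auto simp: subspace_supported_on, auto simp: supported_on_def)

section \<open>Faces and degeneracies of tuples\<close>

lemma act_face_append: "act_face t (Suc (length A)) (A @ x # B) = map (\<lambda>a. t a x) A @ B"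
  by (simp add: act_face_def)

lemma duplicate_append: "duplicate (Suc (length A)) (A @ x # B) = A @ x # x # B"
  by (simp add: duplicate_def)

text \<open>
  Faces and degeneracies become plain list expressions once the positions at which they act are
  exposed by splitting the list; the simplicial relations are then checked by rewriting.
\<close>

lemma split_at_position:
  assumes "1 \<le> i" "i \<le> length xs"
  obtains A x B where "xs = A @ x # B" "i = Suc (length A)"
proof
  show "xs = take (i - 1) xs @ xs ! (i - 1) # drop i xs"
    using assms by (cases i) (auto simp: id_take_nth_drop)
qed (use assms in auto)

lemma split_at_two_positions:
  assumes "1 \<le> i" "i < j" "j \<le> length xs"
  obtains A x B y C where "xs = A @ x # B @ y # C"
    "i = Suc (length A)" "j = Suc (length (A @ x # B))"
proof -
  have "i \<le> length xs" using assms by simp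
  with assms(1) obtain A x R where xs: "xs = A @ x # R" "i = Suc (length A)"
    by (rule split_at_position)
  have "1 \<le> j - i" "j - i \<le> length R" using assms xs by auto
  then obtain B y C where "R = B @ y # C" "j - i = Suc (length B)"
    by (rule split_at_position)
  with xs assms show ?thesis by (intro that[of A x B y C]) auto
qed

text \<open>
  Write the list as \<open>A @ x # B @ y # C\<close> with \<open>x\<close>, \<open>y\<close> at positions \<open>i\<close>, \<open>j\<close>. Both sides delete
  \<open>x\<close> and \<open>y\<close> and apply \<open>u\<close> with \<open>y\<close> to \<open>B\<close>. They differ on \<open>A\<close>: on the left, \<open>u\<close> with
  \<open>y\<close> has already replaced \<open>x\<close> by \<open>u x y\<close> when \<open>t\<close> is applied. Distributivity of \<open>u\<close> over \<open>t\<close>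
  equates the results.
\<close>

lemma act_face_act_face:
  assumes "1 \<le> i" "i < j" "j \<le> length xs" "xs \<in> lists S"
    and distrib: "\<And>a b c. a \<in> S \<Longrightarrow> b \<in> S \<Longrightarrow> c \<in> S \<Longrightarrow> u (t a b) c = t (u a c) (u b c)"
  shows "act_face t i (act_face u j xs) = act_face u (j - 1) (act_face t i xs)"
proof -
  obtain A x B y C where xs: "xs = A @ x # B @ y # C"
    and ij: "i = Suc (length A)" "j = Suc (length (A @ x # B))"
    using split_at_two_positions[OF assms(1-3)] .
  have "act_face t i (act_face u j xs) = map (\<lambda>a. t (u a y) (u x y)) A @ map (\<lambda>a. u a y) B @ C"
    using act_face_append[of u "A @ x # B" y C]
      act_face_append[of t "map (\<lambda>a. u a y) A" "u x y" "map (\<lambda>a. u a y) B @ C"]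
    by (simp add: xs ij o_def)
  moreover have "act_face u (j - 1) (act_face t i xs) = map (\<lambda>a. u (t a x) y) A @ map (\<lambda>a. u a y) B @ C"
    using act_face_append[of t A x "B @ y # C"]
      act_face_append[of u "map (\<lambda>a. t a x) A @ B" y C]
    by (simp add: xs ij o_def)
  ultimately show ?thesis
    using assms(4) distrib by (auto simp: xs)
qed

lemma duplicate_duplicate:
  assumes "1 \<le> i" "i \<le> j" "j \<le> length xs"
  shows "duplicate i (duplicate j xs) = duplicate (j + 1) (duplicate i xs)"
proof (cases "i = j")
  case True
  obtain A x B where "xs = A @ x # B" "i = Suc (length A)"
    using split_at_position[of i xs] assms by auto
  then show ?thesis
    using True duplicate_append[of A x B] duplicate_append[of A x "x # B"]
      duplicate_append[of "A @ [x]" x B] by simp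
next
  case False
  with assms(2) have "i < j" by simp
  with assms(1) obtain A x B y C where "xs = A @ x # B @ y # C"
    "i = Suc (length A)" "j = Suc (length (A @ x # B))"
    using assms(3) by (rule split_at_two_positions)
  then show ?thesis
    using duplicate_append[of A x "B @ y # C"] duplicate_append[of A x "B @ y # y # C"]
      duplicate_append[of "A @ x # B" y C] duplicate_append[of "A @ x # x # B" y C] by simp
qed

lemma act_face_duplicate_less:
  assumes "1 \<le> i" "i < j" "j \<le> length xs"
  shows "act_face t i (duplicate j xs) = duplicate (j - 1) (act_face t i xs)"
proof -
  obtain A x B y C where "xs = A @ x # B @ y # C"
    "i = Suc (length A)" "j = Suc (length (A @ x # B))"
    using split_at_two_positions[OF assms] .
  then show ?thesis
    using duplicate_append[of "A @ x # B" y C] act_face_append[of t A x "B @ y # y # C"]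
      act_face_append[of t A x "B @ y # C"] duplicate_append[of "map (\<lambda>a. t a x) A @ B" y C] by simp
qed

lemma act_face_duplicate_greater:
  assumes "1 \<le> j" "j + 1 < i" "i \<le> length xs + 1"
  shows "act_face t i (duplicate j xs) = duplicate j (act_face t (i - 1) xs)"
proof -
  have "j < i - 1" "i - 1 \<le> length xs" using assms by auto
  with assms(1) obtain A x B y C where "xs = A @ x # B @ y # C"
    "j = Suc (length A)" "i - 1 = Suc (length (A @ x # B))"
    by (rule split_at_two_positions)
  moreover from this assms have "i = Suc (length (A @ x # x # B))" by simp
  ultimately show ?thesis
    using duplicate_append[of A x "B @ y # C"] act_face_append[of t "A @ x # x # B" y C]
      act_face_append[of t "A @ x # B" y C]
      duplicate_append[of "map (\<lambda>a. t a y) A" "t x y" "map (\<lambda>a. t a y) B @ C"] by simp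
qed

text \<open>
  Face \<open>i\<close> deletes the first copy of \<open>x\<close>; face \<open>i + 1\<close> deletes the second one and replaces the
  first by \<open>t x x\<close>.
\<close>

lemma act_face_duplicate_same:
  assumes "1 \<le> i" "i \<le> length xs" "xs \<in> lists S" and idem: "\<And>a. a \<in> S \<Longrightarrow> t a a = a"
  shows "act_face t i (duplicate i xs) = act_face t (i + 1) (duplicate i xs)"
proof -
  obtain A x B where "xs = A @ x # B" "i = Suc (length A)"
    using split_at_position[OF assms(1,2)] .
  with assms(3) idem[of x] show ?thesis
    using duplicate_append[of A x B] act_face_append[of t A x "x # B"]
      act_face_append[of t "A @ [x]" x B] by simp
qed

lemma act_face_tuples:
  assumes "1 \<le> i" "i \<le> n" "xs \<in> tuples S n"
    and closed: "\<And>a b. a \<in> S \<Longrightarrow> b \<in> S \<Longrightarrow> t a b \<in> S"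
  shows "act_face t i xs \<in> tuples S (n - 1)"
proof -
  obtain A x B where "xs = A @ x # B" "i = Suc (length A)"
    using split_at_position[of i xs] assms by (auto simp: tuples_def)
  with assms show ?thesis
    by (auto simp: act_face_append tuples_def)
qed

lemma duplicate_tuples:
  assumes "1 \<le> i" "i \<le> n" "xs \<in> tuples S n"
  shows "duplicate i xs \<in> tuples S (n + 1)"
proof -
  obtain A x B where "xs = A @ x # B" "i = Suc (length A)"
    using split_at_position[of i xs] assms by (auto simp: tuples_def)
  with assms show ?thesis
    by (auto simp: duplicate_append tuples_def)
qed

text \<open>
  This identifies the combinatorially defined \<open>C\<^sup>D\<close> with the span of the images of the degeneracies.
\<close>

lemma degenerate_tuples_eq_duplicates:
  "degenerate_tuples S n = (\<Union>i\<in>{1..n - 1}. duplicate i ` tuples S (n - 1))"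
proof (intro equalityI subsetI)
  fix xs assume "xs \<in> degenerate_tuples S n"
  then obtain i where xs: "xs \<in> tuples S n" and i: "1 \<le> i" "i < n" "xs ! (i - 1) = xs ! i"
    by (auto simp: degenerate_tuples_def)
  have "i \<le> length xs" using xs i by (simp add: tuples_def)
  with i(1) obtain A x B where xs_eq: "xs = A @ x # B" "i = Suc (length A)"
    by (rule split_at_position)
  then obtain C where B: "B = x # C"
    using i xs by (cases B) (auto simp: tuples_def nth_append)
  have "xs = duplicate i (A @ x # C)" "A @ x # C \<in> tuples S (n - 1)"
    using xs xs_eq B duplicate_append[of A x C] by (auto simp: tuples_def)
  then show "xs \<in> (\<Union>i\<in>{1..n - 1}. duplicate i ` tuples S (n - 1))" using i by auto
next
  fix xs assume "xs \<in> (\<Union>i\<in>{1..n - 1}. duplicate i ` tuples S (n - 1))"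
  then obtain i ys where i: "1 \<le> i" "i \<le> n - 1" and ys: "ys \<in> tuples S (n - 1)" "xs = duplicate i ys"
    by auto
  then obtain A x B where "ys = A @ x # B" "i = Suc (length A)"
    using split_at_position[of i ys] by (auto simp: tuples_def)
  then have "xs ! (i - 1) = xs ! i"
    using ys by (simp add: duplicate_append nth_append)
  with i ys duplicate_tuples[OF i ys(1)] show "xs \<in> degenerate_tuples S n"
    by (auto simp: degenerate_tuples_def)
qed

section \<open>The bisimplicial structure of a pair of operations\<close>

lemma omit_face_eq_act_face: "omit_face = act_face (\<lambda>a b. a)"
  by (intro ext) (simp add: omit_face_def act_face_def)

lemma d_omit_eq_d_act: "d_omit = d_act (\<lambda>a b. a)"
  by (intro ext) (simp add: d_omit_def d_act_def omit_face_eq_act_face)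

lemma d_eps_eq_eps_d: "d_eps = eps_d (\<lambda>a b. a)"
  by (simp add: d_eps_def eps_d_def omit_face_eq_act_face)

lemma tensor_space_eq: "tensor_space S = supported_on (lists S)"
  by (simp add: tensor_space_def supported_on_def)

lemma tensor_power_eq: "tensor_power S n = supported_on (tuples S n)"
  by (simp add: tensor_power_def supported_on_def)

text \<open>Transports relations between maps of tuples to their linear extensions.\<close>

lemma linear_extension_map_square:
  assumes "p \<in> supported_on A" "\<And>x. x \<in> A \<Longrightarrow> g (f x) = g' (f' x)"
  shows "linear_extension (\<lambda>y. basis_vec (g y)) (linear_extension (\<lambda>x. basis_vec (f x)) p)
    = linear_extension (\<lambda>y. basis_vec (g' y)) (linear_extension (\<lambda>x. basis_vec (f' x)) p)"
  unfolding linear_extension_linear_extension linear_extension_basis_vec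
  using assms by (intro linear_extension_cong) (auto simp: supported_on_def subset_iff)

lemma eps_d_eq_associated_differential:
  assumes "v \<in> tensor_power S n"
  shows "eps_d t v = associated_differential fscale (d_act t) n v"
proof -
  have "eps_d t v
    = linear_extension (\<lambda>xs. \<Sum>i = 1..n. fscale ((- 1) ^ (i - 1)) (basis_vec (act_face t i xs))) v"
    unfolding eps_d_def using assms
    by (intro linear_extension_cong) (auto simp: tensor_power_def tuples_def)
  then show ?thesis
    by (simp add: linear_extension_sum_scale associated_differential_def d_act_def)
qed

text \<open>
  The four pre-bisimplicial relations are the four choices of a pair of operations from \<open>{t, u}\<close> in
  \<open>act_face_act_face\<close>; the hypothesis is that \<open>t\<close> and \<open>u\<close> form a system of shelf operations that
  distribute over themselves and over each other.
\<close>

lemma pre_bisimplicial_d_act: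
  assumes closed: "\<And>a b. a \<in> S \<Longrightarrow> b \<in> S \<Longrightarrow> t a b \<in> S" "\<And>a b. a \<in> S \<Longrightarrow> b \<in> S \<Longrightarrow> u a b \<in> S"
    and distrib: "\<And>f g a b c. f \<in> {t, u} \<Longrightarrow> g \<in> {t, u} \<Longrightarrow> a \<in> S \<Longrightarrow> b \<in> S \<Longrightarrow> c \<in> S \<Longrightarrow>
      g (f a b) c = f (g a c) (g b c)"
  shows "pre_bisimplicial (fscale :: 'k::field \<Rightarrow> _) (tensor_power S) (d_act t) (d_act u)"
proof -
  have lin: "linear_between fscale (tensor_power S n :: ('a list \<Rightarrow>\<^sub>0 'k) set)
      (tensor_power S (n - 1)) (d_act f n i)"
    if "f \<in> {t, u}" "1 \<le> i" "i \<le> n" for f n i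
    unfolding tensor_power_eq d_act_def
  proof (intro linear_between_linear_extension subspace_supported_on)
    fix xs assume "xs \<in> tuples S n"
    with that(2,3) have "act_face f i xs \<in> tuples S (n - 1)"
      using that(1) closed by (intro act_face_tuples) auto
    then show "basis_vec (act_face f i xs) \<in> supported_on (tuples S (n - 1))" by simp
  qed
  have rel: "d_act f (n - 1) i (d_act g n j v) = d_act g (n - 1) (j - 1) (d_act f n i v)"
    if "f \<in> {t, u}" "g \<in> {t, u}" "1 \<le> i" "i < j" "j \<le> n" "v \<in> tensor_power S n"
    for f g n i j and v :: "'a list \<Rightarrow>\<^sub>0 'k"
    unfolding d_act_def using that distrib[OF that(1,2)]
    by (intro linear_extension_map_square[of _ "tuples S n"] act_face_act_face[where S = S])
      (auto simp: tensor_power_eq tuples_def)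
  show ?thesis
  proof
    show "free.subspace (tensor_power S n :: ('a list \<Rightarrow>\<^sub>0 'k) set)" for n
      by (simp add: tensor_power_eq subspace_supported_on)
  qed (rule lin rel; simp)+
qed

lemma weakly_bisimplicial_d_act:
  assumes "pre_bisimplicial (fscale :: 'k::field \<Rightarrow> _) (tensor_power S) (d_act t) (d_act u)"
    and idem: "\<And>f a. f \<in> {t, u} \<Longrightarrow> a \<in> S \<Longrightarrow> f a a = a"
  shows "weakly_bisimplicial (fscale :: 'k \<Rightarrow> _) (tensor_power S) (d_act t) (d_act u) s_dup"
proof -
  interpret pre_bisimplicial "fscale :: 'k \<Rightarrow> _" "tensor_power S" "d_act t" "d_act u" by fact
  show ?thesis
  proof
    fix n i j :: nat and v :: "'a list \<Rightarrow>\<^sub>0 'k"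
    show "linear_between fscale (tensor_power S n :: ('a list \<Rightarrow>\<^sub>0 'k) set)
        (tensor_power S (n + 1)) (s_dup n i)" if "1 \<le> i" "i \<le> n"
      unfolding tensor_power_eq s_dup_def using that duplicate_tuples
      by (intro linear_between_linear_extension subspace_supported_on) auto
    assume v: "v \<in> tensor_power S n"
    show "s_dup (n + 1) i (s_dup n j v) = s_dup (n + 1) (j + 1) (s_dup n i v)"
      if "1 \<le> i" "i \<le> j" "j \<le> n"
      unfolding s_dup_def using that v duplicate_duplicate
      by (intro linear_extension_map_square[of _ "tuples S n"]) (auto simp: tensor_power_eq tuples_def)
    fix \<delta> :: "nat \<Rightarrow> nat \<Rightarrow> ('a list \<Rightarrow>\<^sub>0 'k) \<Rightarrow> ('a list \<Rightarrow>\<^sub>0 'k)"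
    assume "\<delta> \<in> {d_act t, d_act u}"
    then obtain f where f: "f \<in> {t, u}" and \<delta>: "\<delta> = d_act f" by auto
    show "\<delta> (n + 1) i (s_dup n j v) = s_dup (n - 1) (j - 1) (\<delta> n i v)"
      if "1 \<le> i" "i < j" "j \<le> n"
      unfolding \<delta> d_act_def s_dup_def using that v
      by (intro linear_extension_map_square[of _ "tuples S n"] act_face_duplicate_less)
        (auto simp: tensor_power_eq tuples_def)
    show "\<delta> (n + 1) i (s_dup n j v) = s_dup (n - 1) j (\<delta> n (i - 1) v)"
      if "1 \<le> j" "j + 1 < i" "i \<le> n + 1"
      unfolding \<delta> d_act_def s_dup_def using that v
      by (intro linear_extension_map_square[of _ "tuples S n"] act_face_duplicate_greater)
        (auto simp: tensor_power_eq tuples_def)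
    show "\<delta> (n + 1) i (s_dup n i v) = \<delta> (n + 1) (i + 1) (s_dup n i v)"
      if "1 \<le> i" "i \<le> n"
      unfolding \<delta> d_act_def s_dup_def using that v idem[OF f]
      by (intro linear_extension_map_square[of _ "tuples S n"] act_face_duplicate_same[where S = S])
        (auto simp: tensor_power_eq tuples_def)
  qed
qed

lemma bicomplex_eps_d:
  assumes pre: "pre_bisimplicial (fscale :: 'k::field \<Rightarrow> _) (tensor_power S) (d_act t) (d_act u)"
    and closed: "\<And>a b. a \<in> S \<Longrightarrow> b \<in> S \<Longrightarrow> t a b \<in> S" "\<And>a b. a \<in> S \<Longrightarrow> b \<in> S \<Longrightarrow> u a b \<in> S"
  shows "bicomplex (fscale :: 'k \<Rightarrow> _) (tensor_space S) (tensor_power S) (eps_d t) (eps_d u)"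
proof (rule bicomplex_of_pre_bisimplicial[OF _ pre])
  show "graded_space (fscale :: 'k \<Rightarrow> _) (tensor_space S) (tensor_power S)"
    using graded_space_supported_on[of "lists S" length]
    by (simp add: tensor_space_eq tensor_power_eq[abs_def] tuples_def)
  have "linear_between (fscale :: 'k \<Rightarrow> _) (tensor_space S) (tensor_space S) (eps_d f)"
    if "\<And>a b. a \<in> S \<Longrightarrow> b \<in> S \<Longrightarrow> f a b \<in> S" for f
    unfolding tensor_space_eq eps_d_def
  proof (intro linear_between_linear_extension free.subspace_sum free.subspace_scale subspace_supported_on)
    fix xs i assume "xs \<in> lists S" "i \<in> {1..length xs}"
    then show "basis_vec (act_face f i xs) \<in> supported_on (lists S)"
      using act_face_tuples[of i "length xs" xs S f] that by (auto simp: tuples_def)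
  qed
  with closed show "linear_between (fscale :: 'k \<Rightarrow> _) (tensor_space S) (tensor_space S) (eps_d t)"
    "linear_between (fscale :: 'k \<Rightarrow> _) (tensor_space S) (tensor_space S) (eps_d u)" by auto
qed (rule eps_d_eq_associated_differential, assumption)+

section \<open>The degenerate subcomplex\<close>

lemma CD_component_eq: "CD_component S n = supported_on (degenerate_tuples S n)"
  by (simp add: CD_component_def span_basis_vec)

lemma graded_space_CD: "graded_space (fscale :: 'k::field \<Rightarrow> _) (CD S) (CD_component S)"
proof -
  have "{xs \<in> \<Union>m. degenerate_tuples S m. length xs = n} = degenerate_tuples S n" for n
    by (auto simp: degenerate_tuples_def tuples_def)
  then show ?thesis
    using graded_space_supported_on[of "\<Union>m. degenerate_tuples S m" length]
    by (simp add: CD_def span_basis_vec CD_component_eq[abs_def])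
qed

lemma span_degeneracies_subset_CD_component:
  "free.span (\<Union>k\<in>{1..n - 1}. s_dup (n - 1) k ` tensor_power S (n - 1))
    \<subseteq> (CD_component S n :: ('a list \<Rightarrow>\<^sub>0 'k::field) set)"
proof (rule free.span_minimal)
  have "linear_between fscale (tensor_power S (n - 1)) (CD_component S n :: ('a list \<Rightarrow>\<^sub>0 'k) set)
      (s_dup (n - 1) k)" if "k \<in> {1..n - 1}" for k
    unfolding tensor_power_eq CD_component_eq s_dup_def
    using that by (intro linear_between_linear_extension subspace_supported_on)
      (auto simp: degenerate_tuples_eq_duplicates)
  then show "(\<Union>k\<in>{1..n - 1}. s_dup (n - 1) k ` tensor_power S (n - 1))
    \<subseteq> (CD_component S n :: ('a list \<Rightarrow>\<^sub>0 'k) set)"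
    unfolding linear_between_def by blast
qed (simp add: CD_component_eq subspace_supported_on)

text \<open>
  It suffices to treat a degenerate tuple. It is the image of a degeneracy, so its differential is a
  combination of images of degeneracies, each of which lies in \<open>C\<^sup>D\<close>.
\<close>

lemma eps_d_CD_component:
  assumes "weakly_bisimplicial (fscale :: 'k::field \<Rightarrow> _) (tensor_power S) (d_act t) (d_act u) s_dup"
    and f: "f \<in> {t, u}"
  shows "eps_d f ` (CD_component S (Suc n) :: ('a list \<Rightarrow>\<^sub>0 'k) set) \<subseteq> CD_component S n"
proof -
  interpret weakly_bisimplicial "fscale :: 'k \<Rightarrow> _" "tensor_power S" "d_act t" "d_act u" s_dup by fact
  let ?D = "eps_d f :: ('a list \<Rightarrow>\<^sub>0 'k) \<Rightarrow> _"
  have gen: "?D (basis_vec xs) \<in> CD_component S n" if xs: "xs \<in> degenerate_tuples S (Suc n)" for xs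
  proof -
    obtain j ys where j: "1 \<le> j" "j \<le> n" and ys: "ys \<in> tuples S n" and eq: "xs = duplicate j ys"
      using xs by (auto simp: degenerate_tuples_eq_duplicates)
    have "basis_vec xs = s_dup n j (basis_vec ys)"
      by (simp add: s_dup_def eq)
    moreover have "basis_vec xs \<in> tensor_power S (n + 1)"
      using xs by (simp add: tensor_power_eq degenerate_tuples_def)
    ultimately have "?D (basis_vec xs)
      = associated_differential fscale (d_act f) (n + 1) (s_dup n j (basis_vec ys))"
      using eps_d_eq_associated_differential by metis
    also have "\<dots> \<in> free.span (\<Union>k\<in>{1..n - 1}. s_dup (n - 1) k ` tensor_power S (n - 1))"
      using f ys by (intro associated_differential_degenerate j) (auto simp: tensor_power_eq)
    finally show ?thesis
      using span_degeneracies_subset_CD_component by blast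
  qed
  have "linear_between fscale (supported_on (degenerate_tuples S (Suc n))) (CD_component S n) ?D"
    unfolding eps_d_def
  proof (rule linear_between_linear_extension)
    fix xs assume "xs \<in> degenerate_tuples S (Suc n)"
    from gen[OF this] show "(\<Sum>i = 1..length xs. fscale ((- 1) ^ (i - 1)) (basis_vec (act_face f i xs)))
      \<in> (CD_component S n :: ('a list \<Rightarrow>\<^sub>0 'k) set)"
      unfolding eps_d_def linear_extension_basis_vec .
  qed (simp add: CD_component_eq subspace_supported_on)
  then show ?thesis
    by (simp add: linear_between_def CD_component_eq)
qed

theorem proposition4p13:
  fixes S :: "'a set" and tri :: "'a \<Rightarrow> 'a \<Rightarrow> 'a"
  assumes "shelf S tri"
  shows
    "bicomplex (fscale :: 'k::field \<Rightarrow> ('a list \<Rightarrow>\<^sub>0 'k) \<Rightarrow> ('a list \<Rightarrow>\<^sub>0 'k))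
       (tensor_space S) (tensor_power S) (eps_d tri) d_eps \<and>
     (pre_bisimplicial (fscale :: 'k \<Rightarrow> ('a list \<Rightarrow>\<^sub>0 'k) \<Rightarrow> ('a list \<Rightarrow>\<^sub>0 'k))
        (tensor_power S) (d_act tri) d_omit \<and>
      (\<forall>n. \<forall>v \<in> (tensor_power S n :: ('a list \<Rightarrow>\<^sub>0 'k) set).
         eps_d tri v = associated_differential fscale (d_act tri) n v \<and>
         d_eps v = associated_differential fscale d_omit n v)) \<and>
     (spindle S tri \<longrightarrow>
        weakly_bisimplicial (fscale :: 'k \<Rightarrow> ('a list \<Rightarrow>\<^sub>0 'k) \<Rightarrow> ('a list \<Rightarrow>\<^sub>0 'k))
          (tensor_power S) (d_act tri) d_omit s_dup \<and>
        sub_bicomplex (fscale :: 'k \<Rightarrow> ('a list \<Rightarrow>\<^sub>0 'k) \<Rightarrow> ('a list \<Rightarrow>\<^sub>0 'k))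
          (CD S) (CD_component S) (tensor_space S) (tensor_power S) (eps_d tri) d_eps)"
proof -
  interpret shelf S tri by fact
  let ?triv = "\<lambda>a b :: 'a. a"
  have pre: "pre_bisimplicial (fscale :: 'k \<Rightarrow> _) (tensor_power S) (d_act tri) (d_act ?triv)"
  proof (rule pre_bisimplicial_d_act)
    show "g (f a b) c = f (g a c) (g b c)"
      if "f \<in> {tri, ?triv}" "g \<in> {tri, ?triv}" "a \<in> S" "b \<in> S" "c \<in> S" for f g a b c
      using that(1,2) self_distrib[OF that(3-5)] by (elim insertE emptyE) simp_all
  qed (simp_all add: closed)
  have bi: "bicomplex (fscale :: 'k \<Rightarrow> _) (tensor_space S) (tensor_power S) (eps_d tri) (eps_d ?triv)"
    by (rule bicomplex_eps_d[OF pre]) (auto simp: closed)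
  have weak: "weakly_bisimplicial (fscale :: 'k \<Rightarrow> _) (tensor_power S) (d_act tri) (d_act ?triv) s_dup"
    if "spindle S tri"
    by (rule weakly_bisimplicial_d_act[OF pre]) (use spindle.idem[OF that] in auto)
  have sub: "sub_bicomplex (fscale :: 'k \<Rightarrow> _) (CD S) (CD_component S)
      (tensor_space S) (tensor_power S) (eps_d tri) (eps_d ?triv)" if "spindle S tri"
  proof (rule sub_bicomplexI[OF bi graded_space_CD])
    show "(CD S :: ('a list \<Rightarrow>\<^sub>0 'k) set) \<subseteq> tensor_space S"
      unfolding CD_def span_basis_vec tensor_space_eq
      by (auto simp: supported_on_def degenerate_tuples_def tuples_def subset_iff)
    show "(CD_component S n :: ('a list \<Rightarrow>\<^sub>0 'k) set) \<subseteq> tensor_power S n" for n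
      unfolding CD_component_eq tensor_power_eq
      by (auto simp: supported_on_def degenerate_tuples_def)
  qed (rule eps_d_CD_component[OF weak[OF that]], simp)+
  show ?thesis
    unfolding d_eps_eq_eps_d d_omit_eq_d_act
    by (intro conjI impI allI ballI bi pre weak sub eps_d_eq_associated_differential)
qed

end
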